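(* Let $S$ be an $le$-semigroup with greatest element $\varepsilon$. Then $S$ is semisimple and satisfies condition $\mathbf{\Lambda}$ if and only if the decomposition of $S$ into its $\mathcal{J}$-classes forms a semilattice of left simple $\vee e$-semigroups. Furthermore, when this holds, the $\mathcal{J}$-classes of this decomposition (as $\vee e$-semigroups) are semisimple, intra-regular and satisfy condition $\mathbf{\Lambda}$.
   Context: A $po$-semigroup is a set $S$ with an associative multiplication and a partial order $\leq$ such that $a\leq b$ implies $xa\leq xb$ and $ax\leq bx$ for all $x\in S$. A $poe$-semigroup is a $po$-semigroup with a greatest element, generically denoted $e$. A $\vee e$-semigroup is a $poe$-semigroup that is an upper semilattice (binary joins exist) and in which multiplication distributes over joins: $a(b\vee c)=ab\vee ac$, $(a\vee b)c=ac\vee bc$. An $le$-semigroup is a $\vee e$-semigroup whose order is a lattice. In a $poe$-semigroup $T$ with greatest element $e$: - $x$ is a left ideal element if $ex\leq x$; - $T$ is left simple if $e$ is the only left ideal element of $T$; - $T$ is semisimple if $x\leq e\,x\,e\,x\,e$ for all $x\in T$; - $T$ is intra-regular if $x\leq e x^2 e$ for all $x\in T$; - $T$ satisfies condition $\mathbf{\Lambda}$ if $xy=yx$ for any two left ideal elements $x,y$ of $T$. For the $le$-semigroup $S$ with greatest element $\varepsilon$, put $t(x)=\varepsilon x\varepsilon\vee x\varepsilon\vee\varepsilon x\vee x$. The relation $\mathcal{J}$ is the equivalence relation $\{(x,y)\in S\times S: t(x)=t(y)\}$, and $\mathcal{J}$-classes are its equivalence classes. The decomposition of $S$ into $\mathcal{J}$-classes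 forms a semilattice of left simple $\vee e$-semigroups if the $\mathcal{J}$-classes can be indexed without repetition as $\{S_\alpha:\alpha\in Y\}$ by a semilattice $Y$ (a commutative idempotent semigroup) such that each $S_\alpha$ is a subsemigroup of $S$ which, with the order and multiplication of $S$ restricted to it, is a left simple $\vee e$-semigroup (with its own greatest element), and $S_\alpha\cdot S_\beta\subseteq S_{\alpha\beta}$ for all $\alpha,\beta\in Y$ (the classes being automatically pairwise disjoint with union $S$). The properties semisimple, intra-regular and $\mathbf{\Lambda}$ for a $\mathcal{J}$-class are understood inside that class, with respect to the greatest element of the class. *)

theory Defs
  imports "HOL-Algebra.Lattice"
begin

record 'a ordered_magma = "'a gorder" +
  times :: "['a, 'a] \<Rightarrow> 'a" (infixl \<open>\<cdot>\<index>\<close> 70)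

locale po_semigroup = partial_order T for T :: "('a, 'm) ordered_magma_scheme" (structure) +
  assumes times_closed: "\<lbrakk>x \<in> carrier T; y \<in> carrier T\<rbrakk> \<Longrightarrow> x \<cdot> y \<in> carrier T"
    and times_assoc:
      "\<lbrakk>x \<in> carrier T; y \<in> carrier T; z \<in> carrier T\<rbrakk> \<Longrightarrow> (x \<cdot> y) \<cdot> z = x \<cdot> (y \<cdot> z)"
    and times_left_mono:
      "\<lbrakk>a \<in> carrier T; b \<in> carrier T; x \<in> carrier T; a \<sqsubseteq> b\<rbrakk> \<Longrightarrow> x \<cdot> a \<sqsubseteq> x \<cdot> b"
    and times_right_mono:
      "\<lbrakk>a \<in> carrier T; b \<in> carrier T; x \<in> carrier T; a \<sqsubseteq> b\<rbrakk> \<Longrightarrow> a \<cdot> x \<sqsubseteq> b \<cdot> x"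

text \<open>The greatest element is the library's \<open>\<top>\<^bsub>T\<^esub>\<close>.\<close>

locale poe_semigroup = po_semigroup T + weak_partial_order_top T
  for T :: "('a, 'm) ordered_magma_scheme" (structure)

locale ve_semigroup = poe_semigroup T + upper_semilattice T
  for T :: "('a, 'm) ordered_magma_scheme" (structure) +
  assumes times_join_distrib_left:
      "\<lbrakk>a \<in> carrier T; b \<in> carrier T; c \<in> carrier T\<rbrakk> \<Longrightarrow> a \<cdot> (b \<squnion> c) = a \<cdot> b \<squnion> a \<cdot> c"
    and times_join_distrib_right:
      "\<lbrakk>a \<in> carrier T; b \<in> carrier T; c \<in> carrier T\<rbrakk> \<Longrightarrow> (a \<squnion> b) \<cdot> c = a \<cdot> c \<squnion> b \<cdot> c"

locale le_semigroup = ve_semigroup T + lattice T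
  for T :: "('a, 'm) ordered_magma_scheme" (structure)

definition left_ideal_element :: "('a, 'm) ordered_magma_scheme \<Rightarrow> 'a \<Rightarrow> bool"
  where "left_ideal_element T x \<longleftrightarrow> x \<in> carrier T \<and> \<top>\<^bsub>T\<^esub> \<cdot>\<^bsub>T\<^esub> x \<sqsubseteq>\<^bsub>T\<^esub> x"

definition left_simple :: "('a, 'm) ordered_magma_scheme \<Rightarrow> bool"
  where "left_simple T \<longleftrightarrow> {x. left_ideal_element T x} = {\<top>\<^bsub>T\<^esub>}"

definition semisimple :: "('a, 'm) ordered_magma_scheme \<Rightarrow> bool"
  where "semisimple T \<longleftrightarrow>
    (\<forall>x\<in>carrier T. x \<sqsubseteq>\<^bsub>T\<^esub> \<top>\<^bsub>T\<^esub> \<cdot>\<^bsub>T\<^esub> x \<cdot>\<^bsub>T\<^esub> \<top>\<^bsub>T\<^esub> \<cdot>\<^bsub>T\<^esub> x \<cdot>\<^bsub>T\<^esub> \<top>\<^bsub>T\<^esub>)"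

definition intra_regular :: "('a, 'm) ordered_magma_scheme \<Rightarrow> bool"
  where "intra_regular T \<longleftrightarrow>
    (\<forall>x\<in>carrier T. x \<sqsubseteq>\<^bsub>T\<^esub> \<top>\<^bsub>T\<^esub> \<cdot>\<^bsub>T\<^esub> (x \<cdot>\<^bsub>T\<^esub> x) \<cdot>\<^bsub>T\<^esub> \<top>\<^bsub>T\<^esub>)"

definition condition_Lambda :: "('a, 'm) ordered_magma_scheme \<Rightarrow> bool"
  where "condition_Lambda T \<longleftrightarrow>
    (\<forall>x y. left_ideal_element T x \<longrightarrow> left_ideal_element T y \<longrightarrow> x \<cdot>\<^bsub>T\<^esub> y = y \<cdot>\<^bsub>T\<^esub> x)"

definition ideal_closure :: "('a, 'm) ordered_magma_scheme \<Rightarrow> 'a \<Rightarrow> 'a"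
  where "ideal_closure S x =
    \<top>\<^bsub>S\<^esub> \<cdot>\<^bsub>S\<^esub> x \<cdot>\<^bsub>S\<^esub> \<top>\<^bsub>S\<^esub> \<squnion>\<^bsub>S\<^esub> x \<cdot>\<^bsub>S\<^esub> \<top>\<^bsub>S\<^esub> \<squnion>\<^bsub>S\<^esub> \<top>\<^bsub>S\<^esub> \<cdot>\<^bsub>S\<^esub> x \<squnion>\<^bsub>S\<^esub> x"

definition J_rel :: "('a, 'm) ordered_magma_scheme \<Rightarrow> 'a rel"
  where "J_rel S = {(x, y) \<in> carrier S \<times> carrier S. ideal_closure S x = ideal_closure S y}"

definition J_classes :: "('a, 'm) ordered_magma_scheme \<Rightarrow> 'a set set"
  where "J_classes S = carrier S // J_rel S"

text \<open>Restriction keeps the order and multiplication but not the greatest element or the joins: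
  \<open>\<top>\<close> and \<open>\<squnion>\<close> of the restricted structure are computed inside \<open>C\<close>.\<close>

abbreviation restrict_to ::
    "('a, 'm) ordered_magma_scheme \<Rightarrow> 'a set \<Rightarrow> ('a, 'm) ordered_magma_scheme"
  where "restrict_to S C \<equiv> S\<lparr>carrier := C\<rparr>"

locale semilattice_on =
  fixes Y :: "'i set" and m :: "'i \<Rightarrow> 'i \<Rightarrow> 'i"
  assumes closed: "\<lbrakk>\<alpha> \<in> Y; \<beta> \<in> Y\<rbrakk> \<Longrightarrow> m \<alpha> \<beta> \<in> Y"
    and assoc: "\<lbrakk>\<alpha> \<in> Y; \<beta> \<in> Y; \<gamma> \<in> Y\<rbrakk> \<Longrightarrow> m (m \<alpha> \<beta>) \<gamma> = m \<alpha> (m \<beta> \<gamma>)"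
    and commute: "\<lbrakk>\<alpha> \<in> Y; \<beta> \<in> Y\<rbrakk> \<Longrightarrow> m \<alpha> \<beta> = m \<beta> \<alpha>"
    and idem: "\<alpha> \<in> Y \<Longrightarrow> m \<alpha> \<alpha> = \<alpha>"

text \<open>Closure of each class under multiplication is part of \<open>ve_semigroup\<close> of the restriction.\<close>

definition semilattice_indexing ::
    "('a, 'm) ordered_magma_scheme \<Rightarrow> 'i set \<Rightarrow> ('i \<Rightarrow> 'i \<Rightarrow> 'i) \<Rightarrow> ('i \<Rightarrow> 'a set) \<Rightarrow> bool"
  where "semilattice_indexing S Y m C \<longleftrightarrow>
    semilattice_on Y m \<and>
    bij_betw C Y (J_classes S) \<and>
    (\<forall>\<alpha>\<in>Y. ve_semigroup (restrict_to S (C \<alpha>)) \<and> left_simple (restrict_to S (C \<alpha>))) \<and>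
    (\<forall>\<alpha>\<in>Y. \<forall>\<beta>\<in>Y. \<forall>x\<in>C \<alpha>. \<forall>y\<in>C \<beta>. x \<cdot>\<^bsub>S\<^esub> y \<in> C (m \<alpha> \<beta>))"

text \<open>Indices of type \<^typ>\<open>'a set\<close> lose no generality: the indexing is a bijection onto
  a set of classes, along which any index semilattice can be transported.\<close>

definition J_decomposition_left_simple :: "('a, 'm) ordered_magma_scheme \<Rightarrow> bool"
  where "J_decomposition_left_simple S \<longleftrightarrow>
    (\<exists>(Y :: 'a set set) m C. semilattice_indexing S Y m C)"

end

theory Submission
  imports Defs
begin

text \<open>Write \<open>\<top>\<close> for the greatest element of \<open>S\<close>.

  Suppose that \<open>S\<close> is semisimple and satisfies \<open>\<Lambda>\<close>. Commuting a left ideal element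
  \<open>a\<close> with the left ideal element \<open>\<top>\<close> gives \<open>a \<cdot> \<top> = \<top> \<cdot> a \<sqsubseteq> a\<close>, so left ideal elements
  are two-sided. Semisimplicity then makes them idempotent and gives \<open>x \<sqsubseteq> \<top> \<cdot> x\<close> for every
  \<open>x\<close>. It follows that the ideal closure of \<open>x\<close> is just \<open>\<top> \<cdot> x\<close> and that \<open>x \<mapsto> \<top> \<cdot> x\<close>
  is a homomorphism from \<open>S\<close> onto the left ideal elements, which form a semilattice under
  multiplication (lemma \<open>top_times_hom\<close>). The \<open>\<J>\<close>-classes are its fibres; the fibre of
  \<open>x\<close> has greatest element \<open>\<top> \<cdot> x\<close>, and the homomorphism property makes it a left simple
  \<open>\<or>e\<close>-semigroup. Hence classes multiply as their greatest elements do.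

  Conversely, suppose that the classes form a semilattice of left simple semigroups. In a left
  simple semigroup with greatest element \<open>e\<close>, \<open>e \<cdot> x = e\<close> holds for every \<open>x\<close>
  (lemma \<open>left_simple_top_times\<close>), so every class is semisimple and intra-regular, while \<open>\<Lambda>\<close>
  is trivial for a single left ideal element; semisimplicity of \<open>S\<close> follows from that of the
  classes because \<open>e \<sqsubseteq> \<top>\<close>. A left ideal element of \<open>S\<close> is also one of
  its class, so it is the greatest element of its class. If \<open>a\<close> and \<open>b\<close> are left ideal elements
  of \<open>S\<close>, then so are \<open>a \<cdot> b\<close> and \<open>b \<cdot> a\<close>, and these lie in the same class because the index
  semilattice is commutative; so both are the greatest element of that class.\<close>

section \<open>Left simple semigroups\<close>

lemma (in po_semigroup) times_mono:
  assumes "a \<sqsubseteq> b" "c \<sqsubseteq> d"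
    and "a \<in> carrier T" "b \<in> carrier T" "c \<in> carrier T" "d \<in> carrier T"
  shows "a \<cdot> c \<sqsubseteq> b \<cdot> d"
  using assms by (meson le_trans times_closed times_left_mono times_right_mono)

context poe_semigroup
begin

lemma left_ideal_element_top_times:
  assumes "x \<in> carrier T"
  shows "left_ideal_element T (\<top> \<cdot> x)"
proof -
  have "(\<top> \<cdot> \<top>) \<cdot> x \<sqsubseteq> \<top> \<cdot> x"
    using assms by (intro times_right_mono) (auto simp: times_closed)
  then show ?thesis
    using assms by (simp add: left_ideal_element_def times_assoc times_closed)
qed

lemma left_ideal_element_times:
  assumes "x \<in> carrier T" "left_ideal_element T y"
  shows "left_ideal_element T (y \<cdot> x)"
  using assms times_right_mono[of "\<top> \<cdot> y" y x]
  by (simp add: left_ideal_element_def times_assoc times_closed)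

lemma left_simple_top_times:
  assumes "left_simple T" "x \<in> carrier T"
  shows "\<top> \<cdot> x = \<top>"
  using assms left_ideal_element_top_times unfolding left_simple_def by blast

text \<open>In the left simple case a product that begins with \<open>\<top>\<close> collapses to
  \<open>\<top>\<close>, which is above every element.\<close>

lemma left_simple_semisimple: "left_simple T \<Longrightarrow> semisimple T"
  by (simp add: semisimple_def left_simple_top_times)

lemma left_simple_intra_regular: "left_simple T \<Longrightarrow> intra_regular T"
  by (simp add: intra_regular_def left_simple_top_times times_closed)

lemma left_simple_condition_Lambda: "left_simple T \<Longrightarrow> condition_Lambda T"
  unfolding condition_Lambda_def left_simple_def by (metis mem_Collect_eq singletonD)

end

section \<open>Restriction to a subset\<close>

lemma (in partial_order) top_restrict_eqI:
  assumes "C \<subseteq> carrier L" "t \<in> C" "\<And>x. x \<in> C \<Longrightarrow> x \<sqsubseteq> t"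
  shows "\<top>\<^bsub>L\<lparr>carrier := C\<rparr>\<^esub> = t"
proof -
  have "greatest (L\<lparr>carrier := C\<rparr>) u C \<longleftrightarrow> u = t" for u
    using assms by (auto simp: greatest_def intro: le_antisym)
  then show ?thesis
    by (simp add: top_def)
qed

context ve_semigroup
begin

text \<open>If \<open>C\<close> is closed under the ambient join, then that join is also the least upper bound
  inside \<open>C\<close>, so the distributive laws are inherited.\<close>

lemma ve_semigroup_restrict:
  assumes sub: "C \<subseteq> carrier T"
    and times_in: "\<And>x y. \<lbrakk>x \<in> C; y \<in> C\<rbrakk> \<Longrightarrow> x \<cdot> y \<in> C"
    and join_in: "\<And>x y. \<lbrakk>x \<in> C; y \<in> C\<rbrakk> \<Longrightarrow> x \<squnion> y \<in> C"
    and t: "t \<in> C" "\<And>x. x \<in> C \<Longrightarrow> x \<sqsubseteq> t"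
  shows "ve_semigroup (T\<lparr>carrier := C\<rparr>)"
proof -
  let ?R = "T\<lparr>carrier := C\<rparr>"
  have car: "x \<in> carrier T" if "x \<in> C" for x
    using sub that by blast
  have least_iff: "least ?R l (Upper ?R {x, y}) \<longleftrightarrow> l = x \<squnion> y" if "x \<in> C" "y \<in> C" for x y l
  proof
    assume "least ?R l (Upper ?R {x, y})"
    then have l: "l \<in> C" "x \<sqsubseteq> l" "y \<sqsubseteq> l"
        and min: "\<And>z. \<lbrakk>z \<in> C; x \<sqsubseteq> z; y \<sqsubseteq> z\<rbrakk> \<Longrightarrow> l \<sqsubseteq> z"
      using that by (auto simp: least_def Upper_def)
    have "l \<sqsubseteq> x \<squnion> y"
      using that by (intro min join_in join_left join_right car)
    moreover have "x \<squnion> y \<sqsubseteq> l"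
      using l that by (intro join_le car)
    ultimately show "l = x \<squnion> y"
      using l that by (intro le_antisym car join_in)
  next
    assume "l = x \<squnion> y"
    then show "least ?R l (Upper ?R {x, y})"
      using that car join_in join_left join_right join_le
      by (auto simp: least_def Upper_def)
  qed
  have join_eq: "x \<squnion>\<^bsub>?R\<^esub> y = x \<squnion> y" if "x \<in> C" "y \<in> C" for x y
    using least_iff[OF that] by (simp add: join_def[of ?R] sup_def[of ?R])
  show ?thesis
  proof unfold_locales
    show "\<exists>s. least ?R s (Upper ?R {x, y})" if "x \<in> carrier ?R" "y \<in> carrier ?R" for x y
      using that by (simp add: least_iff)
    show "\<exists>x. greatest ?R x (carrier ?R)"
      using t by (auto simp: greatest_def)
    show "a \<cdot>\<^bsub>?R\<^esub> (b \<squnion>\<^bsub>?R\<^esub> c) = a \<cdot>\<^bsub>?R\<^esub> b \<squnion>\<^bsub>?R\<^esub> a \<cdot>\<^bsub>?R\<^esub> c"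
      if "a \<in> carrier ?R" "b \<in> carrier ?R" "c \<in> carrier ?R" for a b c
      using that by (simp add: join_eq times_in times_join_distrib_left car)
    show "(a \<squnion>\<^bsub>?R\<^esub> b) \<cdot>\<^bsub>?R\<^esub> c = a \<cdot>\<^bsub>?R\<^esub> c \<squnion>\<^bsub>?R\<^esub> b \<cdot>\<^bsub>?R\<^esub> c"
      if "a \<in> carrier ?R" "b \<in> carrier ?R" "c \<in> carrier ?R" for a b c
      using that by (simp add: join_eq times_in times_join_distrib_right car)
    show "x \<sqsubseteq>\<^bsub>?R\<^esub> z"
      if "x \<sqsubseteq>\<^bsub>?R\<^esub> y" "y \<sqsubseteq>\<^bsub>?R\<^esub> z" "x \<in> carrier ?R" "y \<in> carrier ?R" "z \<in> carrier ?R" for x y z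
      using that car le_trans[of x y z] by simp
    show "x .=\<^bsub>?R\<^esub> y"
      if "x \<sqsubseteq>\<^bsub>?R\<^esub> y" "y \<sqsubseteq>\<^bsub>?R\<^esub> x" "x \<in> carrier ?R" "y \<in> carrier ?R" for x y
      using that car le_antisym[of x y] by (simp add: eq_is_equal)
  qed (simp_all add: eq_is_equal car times_in times_assoc times_left_mono times_right_mono)
qed

end

section \<open>Semisimple semigroups with commuting left ideal elements\<close>

locale semisimple_Lambda_semigroup = ve_semigroup +
  assumes semisimple: "semisimple T"
    and Lambda: "condition_Lambda T"
begin

text \<open>Being itself a left ideal element, \<open>\<top>\<close> commutes with every left ideal element.\<close>

lemma left_ideal_times_top:
  assumes "left_ideal_element T a"
  shows "a \<cdot> \<top> = \<top> \<cdot> a" "a \<cdot> \<top> \<sqsubseteq> a"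
proof -
  have "left_ideal_element T \<top>"
    by (simp add: left_ideal_element_def times_closed)
  then show "a \<cdot> \<top> = \<top> \<cdot> a"
    using Lambda assms by (simp add: condition_Lambda_def)
  then show "a \<cdot> \<top> \<sqsubseteq> a"
    using assms by (simp add: left_ideal_element_def)
qed

text \<open>In \<open>\<top> \<cdot> a \<cdot> \<top> \<cdot> a \<cdot> \<top>\<close> the three factors \<open>\<top>\<close> are absorbed by the two-sided ideal
  element \<open>a\<close>, so semisimplicity gives \<open>a \<sqsubseteq> a \<cdot> a\<close>.\<close>

lemma left_ideal_idem:
  assumes "left_ideal_element T a"
  shows "a \<cdot> a = a"
proof (rule le_antisym)
  have a: "a \<in> carrier T" "\<top> \<cdot> a \<sqsubseteq> a" "a \<cdot> \<top> \<sqsubseteq> a"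
    using assms left_ideal_times_top by (auto simp: left_ideal_element_def)
  have "a \<sqsubseteq> \<top> \<cdot> a \<cdot> \<top> \<cdot> a \<cdot> \<top>"
    using semisimple a by (simp add: semisimple_def)
  also have "\<dots> = (\<top> \<cdot> a) \<cdot> \<top> \<cdot> (a \<cdot> \<top>)"
    using a by (simp add: times_assoc times_closed)
  also have "\<dots> \<sqsubseteq> a \<cdot> \<top> \<cdot> a"
    using a by (intro times_mono) (auto simp: times_closed)
  also have "\<dots> \<sqsubseteq> a \<cdot> a"
    using a by (intro times_mono) (auto simp: times_closed)
  finally show "a \<sqsubseteq> a \<cdot> a"
    using a by (simp add: times_closed)
  have "a \<cdot> a \<sqsubseteq> \<top> \<cdot> a"
    using a by (intro times_mono) auto
  then show "a \<cdot> a \<sqsubseteq> a"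
    using a le_trans by (meson times_closed top_closed)
qed (use assms in \<open>auto simp: left_ideal_element_def times_closed\<close>)

text \<open>In \<open>x \<sqsubseteq> (\<top> \<cdot> x) \<cdot> \<top> \<cdot> x \<cdot> \<top>\<close> the two-sided ideal element \<open>\<top> \<cdot> x\<close> absorbs
  everything to its right.\<close>

lemma le_top_times:
  assumes x: "x \<in> carrier T"
  shows "x \<sqsubseteq> \<top> \<cdot> x"
proof -
  have "x \<sqsubseteq> \<top> \<cdot> x \<cdot> \<top> \<cdot> x \<cdot> \<top>"
    using semisimple x by (simp add: semisimple_def)
  also have "\<dots> = \<top> \<cdot> x \<cdot> (\<top> \<cdot> x \<cdot> \<top>)"
    using x by (simp add: times_assoc times_closed)
  also have "\<dots> \<sqsubseteq> \<top> \<cdot> x \<cdot> \<top>"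
    using x by (intro times_left_mono) (auto simp: times_closed)
  also have "\<dots> \<sqsubseteq> \<top> \<cdot> x"
    by (rule left_ideal_times_top(2)[OF left_ideal_element_top_times[OF x]])
  finally show ?thesis
    using x by (simp add: times_closed)
qed

lemma top_times_left_ideal:
  assumes "left_ideal_element T p"
  shows "\<top> \<cdot> p = p"
proof -
  have "p \<in> carrier T" "\<top> \<cdot> p \<sqsubseteq> p"
    using assms by (simp_all add: left_ideal_element_def)
  then show ?thesis
    using le_top_times[of p] by (intro le_antisym) (simp_all add: times_closed)
qed

lemma top_times_top:
  assumes "x \<in> carrier T"
  shows "\<top> \<cdot> x \<cdot> \<top> = \<top> \<cdot> x"
  using left_ideal_times_top(1) top_times_left_ideal left_ideal_element_top_times[OF assms]
  by simp

lemma ideal_closure_eq: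
  assumes x: "x \<in> carrier T"
  shows "ideal_closure T x = \<top> \<cdot> x"
proof -
  have "x \<cdot> \<top> \<sqsubseteq> \<top> \<cdot> x \<cdot> \<top>"
    using x by (intro times_right_mono le_top_times) (auto simp: times_closed)
  then have "x \<cdot> \<top> \<sqsubseteq> \<top> \<cdot> x"
    using x by (simp add: top_times_top)
  then have "\<top> \<cdot> x \<squnion> x \<cdot> \<top> \<squnion> \<top> \<cdot> x \<squnion> x \<sqsubseteq> \<top> \<cdot> x"
    using x le_top_times[OF x] by (intro join_le) (auto simp: times_closed)
  moreover have "\<top> \<cdot> x \<sqsubseteq> (\<top> \<cdot> x \<squnion> x \<cdot> \<top>) \<squnion> \<top> \<cdot> x"
    using x by (intro join_right) (auto simp: times_closed)
  then have "\<top> \<cdot> x \<sqsubseteq> \<top> \<cdot> x \<squnion> x \<cdot> \<top> \<squnion> \<top> \<cdot> x \<squnion> x"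
    using x by (meson join_closed join_left le_trans times_closed top_closed)
  ultimately show ?thesis
    using x unfolding ideal_closure_def top_times_top[OF x]
    by (intro le_antisym) (auto simp: times_closed)
qed

text \<open>The inner \<open>\<top>\<close> of \<open>\<top> \<cdot> x \<cdot> \<top> \<cdot> y\<close> is absorbed on its left by the ideal element
  \<open>\<top> \<cdot> x\<close>. This turns the multiplication of classes into that of left ideal elements.\<close>

lemma top_times_hom:
  assumes "x \<in> carrier T" "y \<in> carrier T"
  shows "\<top> \<cdot> (x \<cdot> y) = (\<top> \<cdot> x) \<cdot> (\<top> \<cdot> y)"
proof -
  have "(\<top> \<cdot> x) \<cdot> (\<top> \<cdot> y) = (\<top> \<cdot> x \<cdot> \<top>) \<cdot> y"
    using assms by (simp add: times_assoc times_closed)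
  also have "\<dots> = (\<top> \<cdot> x) \<cdot> y"
    by (simp only: top_times_top[OF assms(1)])
  also have "\<dots> = \<top> \<cdot> (x \<cdot> y)"
    using assms by (simp add: times_assoc)
  finally show ?thesis ..
qed

text \<open>The \<open>\<J>\<close>-class whose greatest element is the left ideal element \<open>p\<close>; it is empty
  for other \<open>p\<close>.\<close>

definition fibre :: "'a \<Rightarrow> 'a set"
  where "fibre p = {y \<in> carrier T. \<top> \<cdot> y = p}"

lemma J_classes_eq: "J_classes T = fibre ` {p. left_ideal_element T p}"
proof -
  have class_eq: "J_rel T `` {x} = fibre (\<top> \<cdot> x)" if "x \<in> carrier T" for x
    using that by (auto simp: J_rel_def fibre_def ideal_closure_eq)
  have "left_ideal_element T p \<longleftrightarrow> (\<exists>x\<in>carrier T. p = \<top> \<cdot> x)" for p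
  proof
    assume "left_ideal_element T p"
    then have "\<top> \<cdot> p = p" "p \<in> carrier T"
      by (rule top_times_left_ideal, simp add: left_ideal_element_def)
    then show "\<exists>x\<in>carrier T. p = \<top> \<cdot> x"
      by metis
  qed (auto simp: left_ideal_element_top_times)
  then show ?thesis
    by (auto simp: J_classes_def quotient_def class_eq)
qed

lemma fibre_greatest:
  assumes p: "left_ideal_element T p"
  shows "p \<in> fibre p" "\<And>x. x \<in> fibre p \<Longrightarrow> x \<sqsubseteq> p"
  using p top_times_left_ideal[OF p] le_top_times
  by (auto simp: fibre_def left_ideal_element_def)

lemma top_fibre:
  assumes "left_ideal_element T p"
  shows "\<top>\<^bsub>T\<lparr>carrier := fibre p\<rparr>\<^esub> = p"
  using fibre_greatest[OF assms] by (intro top_restrict_eqI) (auto simp: fibre_def)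

text \<open>The map \<open>x \<mapsto> \<top> \<cdot> x\<close> preserves products and joins, and \<open>p\<close> is idempotent for both
  operations, so its fibre over \<open>p\<close> is closed under them.\<close>

lemma ve_semigroup_fibre:
  assumes p: "left_ideal_element T p"
  shows "ve_semigroup (T\<lparr>carrier := fibre p\<rparr>)"
proof (rule ve_semigroup_restrict)
  show "fibre p \<subseteq> carrier T"
    by (simp add: fibre_def)
  show "p \<in> fibre p" and "\<And>x. x \<in> fibre p \<Longrightarrow> x \<sqsubseteq> p"
    using fibre_greatest[OF p] .
  show "x \<cdot> y \<in> fibre p" if "x \<in> fibre p" "y \<in> fibre p" for x y
    using that left_ideal_idem[OF p] by (simp add: fibre_def times_closed top_times_hom)
  have "p \<in> carrier T"
    using p by (simp add: left_ideal_element_def)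
  then have "p \<squnion> p = p"
    by (intro le_antisym join_le join_left join_closed le_refl)
  then show "x \<squnion> y \<in> fibre p" if "x \<in> fibre p" "y \<in> fibre p" for x y
    using that by (simp add: fibre_def times_join_distrib_left)
qed

text \<open>For \<open>x\<close> in the class with greatest element \<open>p = \<top> \<cdot> x = \<top> \<cdot> p\<close>, the homomorphism
  property gives \<open>p \<cdot> x = (\<top> \<cdot> p) \<cdot> x = \<top> \<cdot> (p \<cdot> x) = p \<cdot> p = p\<close>; so \<open>p \<cdot> x \<sqsubseteq> x\<close> forces
  \<open>x = p\<close>.\<close>

lemma left_simple_fibre:
  assumes p: "left_ideal_element T p"
  shows "left_simple (T\<lparr>carrier := fibre p\<rparr>)"
proof -
  have absorb: "p \<cdot> x = p" if "x \<in> fibre p" for x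
  proof -
    have x: "x \<in> carrier T" "\<top> \<cdot> x = p" and p': "p \<in> carrier T" "\<top> \<cdot> p = p"
      using that fibre_greatest(1)[OF p] by (auto simp: fibre_def)
    have "p \<cdot> x = (\<top> \<cdot> p) \<cdot> x"
      using p' by simp
    also have "\<dots> = \<top> \<cdot> (p \<cdot> x)"
      using p'(1) x(1) by (intro times_assoc top_closed)
    also have "\<dots> = p"
      using x p' left_ideal_idem[OF p] by (simp add: top_times_hom)
    finally show ?thesis .
  qed
  have "x = p" if "x \<in> fibre p" "p \<cdot> x \<sqsubseteq> x" for x
    using that fibre_greatest[OF p] absorb
    by (intro le_antisym) (auto simp: fibre_def)
  then show ?thesis
    using fibre_greatest[OF p] absorb
    by (auto simp: left_simple_def left_ideal_element_def top_fibre[OF p])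
qed

text \<open>The classes index themselves; two classes are multiplied by multiplying their greatest
  elements, which are exactly the left ideal elements of \<open>T\<close>.\<close>

lemma J_decomposition: "J_decomposition_left_simple T"
proof -
  define g where "g A = \<top>\<^bsub>T\<lparr>carrier := A\<rparr>\<^esub>" for A
  let ?m = "\<lambda>A B. fibre (g A \<cdot> g B)"
  have g: "g (fibre p) = p" if "left_ideal_element T p" for p
    using top_fibre[OF that] by (simp add: g_def)
  have carr: "p \<in> carrier T" if "left_ideal_element T p" for p
    using that by (simp add: left_ideal_element_def)
  have times: "left_ideal_element T (p \<cdot> q)"
    if "left_ideal_element T p" "left_ideal_element T q" for p q
    using that by (intro left_ideal_element_times carr)
  have "semilattice_on (J_classes T) ?m"
  proof
    fix A B C
    assume "A \<in> J_classes T" "B \<in> J_classes T" "C \<in> J_classes T"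
    then obtain p q r where *: "left_ideal_element T p" "left_ideal_element T q"
        "left_ideal_element T r" "A = fibre p" "B = fibre q" "C = fibre r"
      by (auto simp: J_classes_eq)
    then show "?m (?m A B) C = ?m A (?m B C)"
      by (simp add: g times times_assoc carr)
  next
    fix A B
    assume "A \<in> J_classes T" "B \<in> J_classes T"
    then obtain p q where *: "left_ideal_element T p" "left_ideal_element T q"
        "A = fibre p" "B = fibre q"
      by (auto simp: J_classes_eq)
    then show "?m A B \<in> J_classes T"
      by (auto simp: J_classes_eq g times)
    show "?m A B = ?m B A"
      using * Lambda by (simp add: g condition_Lambda_def)
  next
    fix A
    assume "A \<in> J_classes T"
    then show "?m A A = A"
      by (auto simp: J_classes_eq g left_ideal_idem)
  qed
  moreover have "x \<cdot> y \<in> ?m A B"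
    if "A \<in> J_classes T" "B \<in> J_classes T" "x \<in> A" "y \<in> B" for A B x y
    using that by (auto simp: J_classes_eq g) (auto simp: fibre_def times_closed top_times_hom)
  moreover have "ve_semigroup (T\<lparr>carrier := A\<rparr>) \<and> left_simple (T\<lparr>carrier := A\<rparr>)"
    if "A \<in> J_classes T" for A
    using that by (auto simp: J_classes_eq ve_semigroup_fibre left_simple_fibre)
  ultimately have "semilattice_indexing T (J_classes T) ?m id"
    unfolding semilattice_indexing_def by simp
  then show ?thesis
    unfolding J_decomposition_left_simple_def by blast
qed

end

section \<open>Semilattices of left simple classes\<close>

context poe_semigroup
begin

lemma carrier_eq_Union_J_classes: "carrier T = \<Union> (J_classes T)"
proof -
  have "equiv (carrier T) (J_rel T)"
    by (auto simp: J_rel_def intro!: equivI refl_onI symI transI)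
  then show ?thesis
    by (simp add: J_classes_def Union_quotient)
qed

lemma J_class_left_simple:
  assumes "J_decomposition_left_simple T" "C \<in> J_classes T"
  shows "ve_semigroup (T\<lparr>carrier := C\<rparr>)" "left_simple (T\<lparr>carrier := C\<rparr>)"
proof -
  from assms(1) obtain Y m and I :: "'a set \<Rightarrow> 'a set" where "semilattice_indexing T Y m I"
    by (auto simp: J_decomposition_left_simple_def)
  then have ve: "\<forall>\<alpha>\<in>Y. ve_semigroup (T\<lparr>carrier := I \<alpha>\<rparr>) \<and> left_simple (T\<lparr>carrier := I \<alpha>\<rparr>)"
    and I: "I ` Y = J_classes T"
    by (simp_all add: semilattice_indexing_def bij_betw_def)
  obtain \<alpha> where "\<alpha> \<in> Y" "C = I \<alpha>"
    using assms(2) unfolding I[symmetric] by blast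
  then show "ve_semigroup (T\<lparr>carrier := C\<rparr>)" "left_simple (T\<lparr>carrier := C\<rparr>)"
    using ve by simp_all
qed

text \<open>The greatest element \<open>e\<close> of a class is below \<open>\<top>\<close>, so semisimplicity of the class,
  \<open>x \<sqsubseteq> e \<cdot> x \<cdot> e \<cdot> x \<cdot> e\<close>, passes to the whole.\<close>

lemma J_decomposition_semisimple:
  assumes "J_decomposition_left_simple T"
  shows "semisimple T"
  unfolding semisimple_def
proof
  fix x
  assume x: "x \<in> carrier T"
  then obtain C where C: "C \<in> J_classes T" "x \<in> C"
    by (auto simp: carrier_eq_Union_J_classes)
  let ?R = "T\<lparr>carrier := C\<rparr>"
  interpret R: ve_semigroup ?R
    using assms C(1) by (rule J_class_left_simple)
  define e where "e = \<top>\<^bsub>?R\<^esub>"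
  have "e \<in> C"
    using R.top_closed by (simp add: e_def)
  then have e: "e \<in> carrier T"
    using C(1) by (auto simp: carrier_eq_Union_J_classes)
  have "semisimple ?R"
    using assms C(1) by (intro R.left_simple_semisimple J_class_left_simple)
  then have "x \<sqsubseteq> e \<cdot> x \<cdot> e \<cdot> x \<cdot> e"
    using C(2) by (simp add: semisimple_def e_def)
  also have "\<dots> \<sqsubseteq> \<top> \<cdot> x \<cdot> \<top> \<cdot> x \<cdot> \<top>"
    using e x by (intro times_mono) (auto simp: times_closed)
  finally show "x \<sqsubseteq> \<top> \<cdot> x \<cdot> \<top> \<cdot> x \<cdot> \<top>"
    using e x by (simp add: times_closed)
qed

text \<open>A left ideal element \<open>a\<close> satisfies \<open>e \<cdot> a \<sqsubseteq> \<top> \<cdot> a \<sqsubseteq> a\<close> for the greatest element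
  \<open>e\<close> of its class, so it is a left ideal element of that class as well.\<close>

lemma left_ideal_element_eq_class_top:
  assumes "J_decomposition_left_simple T" "C \<in> J_classes T"
    and a: "left_ideal_element T a" "a \<in> C"
  shows "a = \<top>\<^bsub>T\<lparr>carrier := C\<rparr>\<^esub>"
proof -
  let ?R = "T\<lparr>carrier := C\<rparr>"
  interpret R: ve_semigroup ?R
    using assms(1,2) by (rule J_class_left_simple)
  define e where "e = \<top>\<^bsub>?R\<^esub>"
  have "e \<in> C"
    using R.top_closed by (simp add: e_def)
  then have e: "e \<in> carrier T"
    using assms(2) by (auto simp: carrier_eq_Union_J_classes)
  have "e \<cdot> a \<sqsubseteq> \<top> \<cdot> a"
    using e a by (intro times_right_mono) (auto simp: left_ideal_element_def)
  then have "e \<cdot> a \<sqsubseteq> a"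
    using e a by (meson le_trans left_ideal_element_def times_closed top_closed)
  then have "left_ideal_element ?R a"
    using a by (simp add: left_ideal_element_def e_def)
  then show ?thesis
    using J_class_left_simple(2)[OF assms(1,2)] by (auto simp: left_simple_def)
qed

lemma J_decomposition_condition_Lambda:
  assumes dec: "J_decomposition_left_simple T"
  shows "condition_Lambda T"
  unfolding condition_Lambda_def
proof (intro allI impI)
  fix a b
  assume a: "left_ideal_element T a" and b: "left_ideal_element T b"
  then have carr: "a \<in> carrier T" "b \<in> carrier T"
    by (auto simp: left_ideal_element_def)
  from dec obtain Y m and I :: "'a set \<Rightarrow> 'a set" where ind: "semilattice_indexing T Y m I"
    by (auto simp: J_decomposition_left_simple_def)
  then interpret semilattice_on Y m
    by (simp add: semilattice_indexing_def)
  have I: "I ` Y = J_classes T"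
    and times_in: "\<And>\<alpha> \<beta> x y. \<lbrakk>\<alpha> \<in> Y; \<beta> \<in> Y; x \<in> I \<alpha>; y \<in> I \<beta>\<rbrakk> \<Longrightarrow> x \<cdot> y \<in> I (m \<alpha> \<beta>)"
    using ind by (auto simp: semilattice_indexing_def bij_betw_def)
  obtain \<alpha> \<beta> where \<alpha>\<beta>: "\<alpha> \<in> Y" "\<beta> \<in> Y" "a \<in> I \<alpha>" "b \<in> I \<beta>"
    using carr unfolding carrier_eq_Union_J_classes I[symmetric] by blast
  let ?C = "I (m \<alpha> \<beta>)"
  have C: "?C \<in> J_classes T"
    using \<alpha>\<beta> I closed by blast
  have "a \<cdot> b \<in> ?C" "b \<cdot> a \<in> ?C"
    using \<alpha>\<beta> times_in[of \<alpha> \<beta> a b] times_in[of \<beta> \<alpha> b a] commute[of \<beta> \<alpha>] by auto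
  then have "a \<cdot> b = \<top>\<^bsub>T\<lparr>carrier := ?C\<rparr>\<^esub>" "b \<cdot> a = \<top>\<^bsub>T\<lparr>carrier := ?C\<rparr>\<^esub>"
    using a b carr by (intro left_ideal_element_eq_class_top[OF dec C] left_ideal_element_times; simp)+
  then show "a \<cdot> b = b \<cdot> a"
    by simp
qed

end

theorem proposition2p3:
  fixes S :: "('a, 'm) ordered_magma_scheme"
  assumes "le_semigroup S"
  shows "(semisimple S \<and> condition_Lambda S \<longleftrightarrow> J_decomposition_left_simple S) \<and>
    (J_decomposition_left_simple S \<longrightarrow>
      (\<forall>C\<in>J_classes S.
        ve_semigroup (restrict_to S C) \<and>
        semisimple (restrict_to S C) \<and>
        intra_regular (restrict_to S C) \<and>
        condition_Lambda (restrict_to S C)))"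
proof -
  interpret le_semigroup S
    by (fact assms)
  have "J_decomposition_left_simple S" if "semisimple S" "condition_Lambda S"
  proof -
    interpret semisimple_Lambda_semigroup S
      using that by unfold_locales
    show ?thesis
      by (rule J_decomposition)
  qed
  moreover have "ve_semigroup (restrict_to S C) \<and> semisimple (restrict_to S C) \<and>
      intra_regular (restrict_to S C) \<and> condition_Lambda (restrict_to S C)"
    if "J_decomposition_left_simple S" "C \<in> J_classes S" for C
  proof -
    interpret R: ve_semigroup "restrict_to S C"
      using that by (rule J_class_left_simple)
    show ?thesis
      using J_class_left_simple(2)[OF that] R.ve_semigroup_axioms
      by (simp add: R.left_simple_semisimple R.left_simple_intra_regular
          R.left_simple_condition_Lambda)
  qed
  ultimately show ?thesis
    using J_decomposition_semisimple J_decomposition_condition_Lambda by blast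
qed

end
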